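(* (1) A quasi-distributive, linearly distributive skew lattice satisfies the identity $$x\wedge (y\vee z)\wedge x = (x\wedge y\wedge x)\vee (x\wedge z\wedge x)$$ if and only if it satisfies the identity $$x\wedge ((y\wedge x\wedge y)\vee z\vee y\vee z\vee( y\wedge x\wedge y))\wedge x = x\wedge (y\vee z\vee y)\wedge x.\qquad (\ast)$$ (2) Likewise, a quasi-distributive, linearly distributive skew lattice satisfies the identity $$x\vee (y\wedge z)\vee x = (x\vee y\vee x)\wedge (x\vee z\vee x)$$ if and only if it satisfies the dual of $(\ast)$, namely $$x\vee ((y\vee x\vee y)\wedge z\wedge y\wedge z\wedge( y\vee x\vee y))\vee x = x\vee (y\wedge z\wedge y)\vee x.\qquad (\ast\ast)$$ (3) A skew lattice is distributive if and only if it is quasi-distributive, linearly distributive and satisfies both $(\ast)$ and $(\ast\ast)$.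
   Context: A skew lattice is a set $S$ with two associative, idempotent binary operations $\wedge,\vee$ satisfying $x\wedge (x\vee y) = x = (y\vee x)\wedge x$ and $x\vee (x\wedge y) = x = (y\wedge x)\vee x$. It is distributive if it satisfies both $x\wedge (y\vee z)\wedge x = (x\wedge y\wedge x)\vee (x\wedge z\wedge x)$ and $x\vee (y\wedge z)\vee x = (x\vee y\vee x)\wedge (x\vee z\vee x)$. The natural preorder is $a\succeq b$ iff $a\vee b\vee a=a$ (equivalently $b\wedge a\wedge b=b$). The relation $a\mathrel{\mathcal D}b$ iff $a\succeq b$ and $b\succeq a$ is a congruence, and $S/\mathcal D$ is the maximal lattice image of $S$. $S$ is quasi-distributive if $S/\mathcal D$ is a distributive lattice. $S$ is linearly distributive if every subalgebra $T$ of $S$ that is totally preordered (for all $a,b\in T$, $a\succeq b$ or $b\succeq a$) is distributive. *)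

theory Defs
  imports Main
begin

text \<open>Algebras are given by a carrier set and two binary operations on the ambient type;
  the carrier need not be the whole type, so that subalgebras and the quotient modulo
  \<open>\<D>\<close> are algebras of the same kind.\<close>

locale skew_lattice =
  fixes meet :: "'a \<Rightarrow> 'a \<Rightarrow> 'a"  (infixl "\<sqinter>" 70)
    and join :: "'a \<Rightarrow> 'a \<Rightarrow> 'a"  (infixl "\<squnion>" 70)
    and S :: "'a set"
  assumes meet_closed: "\<lbrakk>x \<in> S; y \<in> S\<rbrakk> \<Longrightarrow> x \<sqinter> y \<in> S"
    and join_closed: "\<lbrakk>x \<in> S; y \<in> S\<rbrakk> \<Longrightarrow> x \<squnion> y \<in> S"
    and meet_assoc: "\<lbrakk>x \<in> S; y \<in> S; z \<in> S\<rbrakk> \<Longrightarrow> (x \<sqinter> y) \<sqinter> z = x \<sqinter> (y \<sqinter> z)"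
    and join_assoc: "\<lbrakk>x \<in> S; y \<in> S; z \<in> S\<rbrakk> \<Longrightarrow> (x \<squnion> y) \<squnion> z = x \<squnion> (y \<squnion> z)"
    and meet_idem: "x \<in> S \<Longrightarrow> x \<sqinter> x = x"
    and join_idem: "x \<in> S \<Longrightarrow> x \<squnion> x = x"
    and meet_absorb_left: "\<lbrakk>x \<in> S; y \<in> S\<rbrakk> \<Longrightarrow> x \<sqinter> (x \<squnion> y) = x"
    and meet_absorb_right: "\<lbrakk>x \<in> S; y \<in> S\<rbrakk> \<Longrightarrow> (y \<squnion> x) \<sqinter> x = x"
    and join_absorb_left: "\<lbrakk>x \<in> S; y \<in> S\<rbrakk> \<Longrightarrow> x \<squnion> (x \<sqinter> y) = x"
    and join_absorb_right: "\<lbrakk>x \<in> S; y \<in> S\<rbrakk> \<Longrightarrow> (y \<sqinter> x) \<squnion> x = x"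

locale distributive_lattice_on =
  fixes meet :: "'a \<Rightarrow> 'a \<Rightarrow> 'a"  (infixl "\<sqinter>" 70)
    and join :: "'a \<Rightarrow> 'a \<Rightarrow> 'a"  (infixl "\<squnion>" 70)
    and L :: "'a set"
  assumes meet_closed: "\<lbrakk>x \<in> L; y \<in> L\<rbrakk> \<Longrightarrow> x \<sqinter> y \<in> L"
    and join_closed: "\<lbrakk>x \<in> L; y \<in> L\<rbrakk> \<Longrightarrow> x \<squnion> y \<in> L"
    and meet_assoc: "\<lbrakk>x \<in> L; y \<in> L; z \<in> L\<rbrakk> \<Longrightarrow> (x \<sqinter> y) \<sqinter> z = x \<sqinter> (y \<sqinter> z)"
    and join_assoc: "\<lbrakk>x \<in> L; y \<in> L; z \<in> L\<rbrakk> \<Longrightarrow> (x \<squnion> y) \<squnion> z = x \<squnion> (y \<squnion> z)"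
    and meet_commute: "\<lbrakk>x \<in> L; y \<in> L\<rbrakk> \<Longrightarrow> x \<sqinter> y = y \<sqinter> x"
    and join_commute: "\<lbrakk>x \<in> L; y \<in> L\<rbrakk> \<Longrightarrow> x \<squnion> y = y \<squnion> x"
    and meet_absorb: "\<lbrakk>x \<in> L; y \<in> L\<rbrakk> \<Longrightarrow> x \<sqinter> (x \<squnion> y) = x"
    and join_absorb: "\<lbrakk>x \<in> L; y \<in> L\<rbrakk> \<Longrightarrow> x \<squnion> (x \<sqinter> y) = x"
    and distrib: "\<lbrakk>x \<in> L; y \<in> L; z \<in> L\<rbrakk> \<Longrightarrow> x \<sqinter> (y \<squnion> z) = (x \<sqinter> y) \<squnion> (x \<sqinter> z)"

context
  fixes meet :: "'a \<Rightarrow> 'a \<Rightarrow> 'a"  (infixl "\<sqinter>" 70)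
    and join :: "'a \<Rightarrow> 'a \<Rightarrow> 'a"  (infixl "\<squnion>" 70)
begin

definition meet_distributive :: "'a set \<Rightarrow> bool" where
  "meet_distributive S \<longleftrightarrow> (\<forall>x\<in>S. \<forall>y\<in>S. \<forall>z\<in>S.
     x \<sqinter> (y \<squnion> z) \<sqinter> x = (x \<sqinter> y \<sqinter> x) \<squnion> (x \<sqinter> z \<sqinter> x))"

definition join_distributive :: "'a set \<Rightarrow> bool" where
  "join_distributive S \<longleftrightarrow> (\<forall>x\<in>S. \<forall>y\<in>S. \<forall>z\<in>S.
     x \<squnion> (y \<sqinter> z) \<squnion> x = (x \<squnion> y \<squnion> x) \<sqinter> (x \<squnion> z \<squnion> x))"

definition distributive :: "'a set \<Rightarrow> bool" where
  "distributive S \<longleftrightarrow> meet_distributive S \<and> join_distributive S"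

definition natural_preorder :: "'a \<Rightarrow> 'a \<Rightarrow> bool"  (infix "\<succeq>" 50) where
  "a \<succeq> b \<longleftrightarrow> a \<squnion> b \<squnion> a = a"

definition D_rel :: "'a set \<Rightarrow> ('a \<times> 'a) set" where
  "D_rel S = {(a, b). a \<in> S \<and> b \<in> S \<and> a \<succeq> b \<and> b \<succeq> a}"

text \<open>The operation induced by \<open>f\<close> on \<open>\<D>\<close>-classes. As \<open>\<D>\<close> is a congruence, all the classes in
  the union coincide with the class of \<open>f a b\<close>, for any representatives \<open>a\<close> and \<open>b\<close>.\<close>

definition quotient_op :: "'a set \<Rightarrow> ('a \<Rightarrow> 'a \<Rightarrow> 'a) \<Rightarrow> 'a set \<Rightarrow> 'a set \<Rightarrow> 'a set" where
  "quotient_op S f A B = (\<Union>a\<in>A. \<Union>b\<in>B. D_rel S `` {f a b})"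

definition quasi_distributive :: "'a set \<Rightarrow> bool" where
  "quasi_distributive S \<longleftrightarrow>
     distributive_lattice_on (quotient_op S (\<sqinter>)) (quotient_op S (\<squnion>)) (S // D_rel S)"

definition subalgebra :: "'a set \<Rightarrow> 'a set \<Rightarrow> bool" where
  "subalgebra T S \<longleftrightarrow> T \<subseteq> S \<and> (\<forall>x\<in>T. \<forall>y\<in>T. x \<sqinter> y \<in> T \<and> x \<squnion> y \<in> T)"

definition linearly_distributive :: "'a set \<Rightarrow> bool" where
  "linearly_distributive S \<longleftrightarrow>
     (\<forall>T. subalgebra T S \<and> (\<forall>a\<in>T. \<forall>b\<in>T. a \<succeq> b \<or> b \<succeq> a) \<longrightarrow> distributive T)"

definition identity_star :: "'a set \<Rightarrow> bool" where
  "identity_star S \<longleftrightarrow> (\<forall>x\<in>S. \<forall>y\<in>S. \<forall>z\<in>S.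
     x \<sqinter> ((y \<sqinter> x \<sqinter> y) \<squnion> z \<squnion> y \<squnion> z \<squnion> (y \<sqinter> x \<sqinter> y)) \<sqinter> x = x \<sqinter> (y \<squnion> z \<squnion> y) \<sqinter> x)"

definition identity_star_dual :: "'a set \<Rightarrow> bool" where
  "identity_star_dual S \<longleftrightarrow> (\<forall>x\<in>S. \<forall>y\<in>S. \<forall>z\<in>S.
     x \<squnion> ((y \<squnion> x \<squnion> y) \<sqinter> z \<sqinter> y \<sqinter> z \<sqinter> (y \<squnion> x \<squnion> y)) \<squnion> x = x \<squnion> (y \<sqinter> z \<sqinter> y) \<squnion> x)"

end

end

theory Submission imports Defs
begin

text \<open>
  For an element \<open>x\<close> let \<open>under x t = x \<sqinter> t \<sqinter> x\<close>. Meet distributivity says that every map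
  \<open>under x\<close> preserves joins, so the question is how much of this survives when distributivity
  is known only on chains of \<open>\<D>\<close>-classes.

  Both meet and join are regular band operations (\<open>meet_regular\<close>), hence \<open>under x\<close> preserves
  meets, and it preserves joins of \<open>\<D>\<close>-related elements, because in a \<open>\<D>\<close>-class the join is the
  reversed meet. Joins of comparable elements suffice: with \<open>p = y \<squnion> z\<close> one has \<open>y \<squnion> z \<squnion> p = p\<close> and
  \<open>p \<squnion> y \<squnion> z = p\<close>, where each join is one of comparable elements, so \<open>q = under x y \<squnion> under x z\<close>
  is absorbed by \<open>under x p\<close> on both sides; quasi-distributivity puts \<open>q\<close> and \<open>under x p\<close> in the
  same \<open>\<D>\<close>-class, and then they are equal (\<open>meet_distributive_if_star\<close>).

  It remains to split \<open>under x (y \<squnion> s)\<close> when \<open>s \<succeq> y\<close> but \<open>x\<close> is unrelated to both. If \<open>x \<succeq> y\<close>, one may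
  replace \<open>s\<close> by \<open>under s x\<close>, which is dominated by \<open>x\<close> and has the same image under \<open>x\<close>; the three
  elements then form a chain (\<open>under_sandwich_join\<close>). In general \<open>y\<close> has to be replaced by
  \<open>under y x\<close>, and that this does not change the image under \<open>x\<close> is exactly what
  \<open>identity_star\<close> says for comparable \<open>y\<close> and \<open>s\<close> (\<open>under_join_comparable\<close>).

  Interchanging meet and join turns skew lattices into skew lattices and preserves
  quasi-distributivity and linear distributivity, so the statements about
  join distributivity are the duals of those about meet distributivity.
\<close>

section \<open>Duality for distributive lattices\<close>

lemma (in distributive_lattice_on) distributive_lattice_on_order_dual:
  "distributive_lattice_on (\<squnion>) (\<sqinter>) L"
proof
  fix x y z assume L: "x \<in> L" "y \<in> L" "z \<in> L"
  show "x \<squnion> (y \<sqinter> z) = (x \<squnion> y) \<sqinter> (x \<squnion> z)"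
  proof -
    have "(x \<squnion> y) \<sqinter> (x \<squnion> z) = ((x \<squnion> y) \<sqinter> x) \<squnion> ((x \<squnion> y) \<sqinter> z)"
      using L by (simp add: distrib join_closed)
    also have "\<dots> = x \<squnion> ((z \<sqinter> x) \<squnion> (z \<sqinter> y))"
      using L by (simp add: meet_commute[of "x \<squnion> y"] meet_absorb join_closed distrib)
    also have "\<dots> = (x \<squnion> (x \<sqinter> z)) \<squnion> (y \<sqinter> z)"
      using L by (simp add: join_assoc meet_closed meet_commute[of z])
    finally show ?thesis using L by (simp add: join_absorb)
  qed
qed (fact meet_closed join_closed meet_assoc join_assoc meet_commute join_commute
    meet_absorb join_absorb)+

section \<open>Two symmetries of skew lattices and the natural preorder\<close>

context skew_lattice
begin

abbreviation dominates :: "'a \<Rightarrow> 'a \<Rightarrow> bool"  (infix "\<succeq>" 50) where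
  "a \<succeq> b \<equiv> natural_preorder (\<squnion>) a b"

lemma order_dual: "skew_lattice (\<squnion>) (\<sqinter>) S"
  by unfold_locales
    (fact meet_closed join_closed meet_assoc join_assoc meet_idem join_idem
      meet_absorb_left meet_absorb_right join_absorb_left join_absorb_right)+

lemma mirror: "skew_lattice (\<lambda>x y. y \<sqinter> x) (\<lambda>x y. y \<squnion> x) S"
  by unfold_locales
    (simp_all add: meet_closed join_closed meet_assoc join_assoc meet_idem join_idem
      meet_absorb_left meet_absorb_right join_absorb_left join_absorb_right)

declare meet_closed [simp, intro] join_closed [simp, intro] meet_idem [simp] join_idem [simp]

lemma meet_left_idem [simp]: "\<lbrakk>x \<in> S; y \<in> S\<rbrakk> \<Longrightarrow> x \<sqinter> (x \<sqinter> y) = x \<sqinter> y"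
  by (metis meet_assoc meet_idem)

lemma meet_pair_idem [simp]:
  assumes "x \<in> S" "y \<in> S" shows "x \<sqinter> (y \<sqinter> (x \<sqinter> y)) = x \<sqinter> y"
  using meet_idem[of "x \<sqinter> y"] assms by (simp add: meet_assoc del: meet_idem)

lemmas join_left_idem [simp] = skew_lattice.meet_left_idem[OF order_dual]
lemmas join_pair_idem [simp] = skew_lattice.meet_pair_idem[OF order_dual]

text \<open>This description of the elements dominated by \<open>a\<close>, as multiples of \<open>a\<close> for the meet, is the source of
  the order properties below. Writing \<open>p = b \<sqinter> a\<close>, absorption gives \<open>p \<squnion> (p \<sqinter> c) \<squnion> a = p \<squnion> a = a\<close>, so
  joining \<open>(p \<sqinter> c) \<squnion> a\<close> on the right once more changes nothing.\<close>

lemma dominates_factor: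
  assumes "a \<in> S" "b \<in> S" "c \<in> S"
  shows "a \<succeq> b \<sqinter> a \<sqinter> c"
proof -
  let ?p = "b \<sqinter> a"
  have pa: "?p \<squnion> a = a" using assms by (simp add: join_absorb_right)
  have "?p \<squnion> ((?p \<sqinter> c) \<squnion> a) = a"
    using assms pa by (simp add: join_assoc[symmetric] join_absorb_left)
  then have "a \<squnion> ((?p \<sqinter> c) \<squnion> a) = ?p \<squnion> ((?p \<sqinter> c) \<squnion> a) \<squnion> ((?p \<sqinter> c) \<squnion> a)"
    by simp
  also have "\<dots> = ?p \<squnion> ((?p \<sqinter> c) \<squnion> a)" 
    using assms by (simp add: join_assoc)
  also have "\<dots> = a" by fact
  finally show ?thesis using assms by (simp add: natural_preorder_def join_assoc)
qed

lemma dominates_meet_iff: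
  assumes "a \<in> S" "b \<in> S"
  shows "a \<succeq> b \<longleftrightarrow> b \<sqinter> a \<sqinter> b = b"
proof
  assume "a \<succeq> b"
  then show "b \<sqinter> a \<sqinter> b = b"
    using skew_lattice.dominates_factor[OF order_dual, of b a a] assms
    by (simp add: natural_preorder_def)
next
  assume "b \<sqinter> a \<sqinter> b = b"
  then show "a \<succeq> b"
    using dominates_factor[of a b b] assms by simp
qed

lemma dominates_order_dual:
  assumes "a \<in> S" "b \<in> S"
  shows "natural_preorder (\<sqinter>) a b \<longleftrightarrow> b \<succeq> a"
  using assms by (simp add: dominates_meet_iff[of b a] natural_preorder_def[of "(\<sqinter>)"])

section \<open>Regularity\<close>

text \<open>The hypotheses say that \<open>u\<close> and \<open>w\<close> are \<open>\<R>\<close>-related for the meet. That \<open>u\<close> and \<open>w\<close> act alike on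
  \<open>t \<sqinter> w\<close> needs the join: the element \<open>q = w \<squnion> (t \<sqinter> w)\<close> is a left identity for \<open>t \<sqinter> w\<close>, while
  \<open>u \<sqinter> q = w\<close>, so \<open>u \<sqinter> (t \<sqinter> w) = u \<sqinter> q \<sqinter> (t \<sqinter> w) = w \<sqinter> (t \<sqinter> w)\<close>.\<close>

lemma meet_R_translate:
  assumes S: "u \<in> S" "w \<in> S" "t \<in> S" and uw: "u \<sqinter> w = w" "w \<sqinter> u = u"
  shows "u \<sqinter> t \<sqinter> w = w \<sqinter> t \<sqinter> w"
proof -
  define q where "q = w \<squnion> (t \<sqinter> w)"
  have q: "q \<in> S" using S by (simp add: q_def)
  have "q \<squnion> w = w"
    using S by (simp add: q_def join_assoc join_absorb_right)
  then have qw: "q \<sqinter> w = q"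
    using meet_absorb_left[of q w] q S by simp
  have "w \<sqinter> q = w"
    using S by (simp add: q_def meet_absorb_left)
  then have "q \<succeq> u"
    using dominates_factor[of q w u] q S uw by simp
  then have uqu: "u \<sqinter> q \<sqinter> u = u"
    using q S by (simp add: dominates_meet_iff)
  have "u \<sqinter> q = u \<sqinter> q \<sqinter> (u \<sqinter> w)"
    using qw uw q S by (simp add: meet_assoc)
  also have "\<dots> = (u \<sqinter> q \<sqinter> u) \<sqinter> w"
    using q S by (simp add: meet_assoc)
  also have "\<dots> = w"
    using uqu uw by simp
  finally have uq: "u \<sqinter> q = w" .
  have qt: "q \<sqinter> (t \<sqinter> w) = t \<sqinter> w"
    using S by (simp add: q_def meet_absorb_right)
  have "u \<sqinter> t \<sqinter> w = u \<sqinter> (q \<sqinter> (t \<sqinter> w))"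
    using S qt by (simp add: meet_assoc)
  also have "\<dots> = w \<sqinter> (t \<sqinter> w)"
    using S q uq by (simp add: meet_assoc[symmetric])
  finally show ?thesis using S by (simp add: meet_assoc)
qed

lemma meet_L_translate:
  assumes "u \<in> S" "w \<in> S" "t \<in> S" "w \<sqinter> u = w" "u \<sqinter> w = u"
  shows "w \<sqinter> t \<sqinter> u = w \<sqinter> t \<sqinter> w"
  using skew_lattice.meet_R_translate[OF mirror, of u w t] assms by (simp add: meet_assoc)

text \<open>The two sides \<open>Q\<close> and \<open>P\<close> are compared through \<open>Q \<sqinter> P\<close>. On the one hand \<open>x \<sqinter> a\<close> and \<open>x \<sqinter> a \<sqinter> x\<close> are
  \<open>\<R>\<close>-related, which yields \<open>Q \<sqinter> P = P\<close>; on the other hand \<open>b \<sqinter> x\<close> and \<open>x \<sqinter> b \<sqinter> x\<close> are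
  \<open>\<L>\<close>-related, which yields \<open>Q \<sqinter> P = Q\<close>.\<close>

lemma meet_regular:
  assumes S: "x \<in> S" "a \<in> S" "b \<in> S"
  shows "x \<sqinter> a \<sqinter> x \<sqinter> b \<sqinter> x = x \<sqinter> a \<sqinter> b \<sqinter> x"
proof -
  let ?P = "x \<sqinter> a \<sqinter> b \<sqinter> x" and ?Q = "x \<sqinter> a \<sqinter> x \<sqinter> b \<sqinter> x"
  have "(x \<sqinter> a \<sqinter> x) \<sqinter> (b \<sqinter> x) \<sqinter> (x \<sqinter> a) = (x \<sqinter> a) \<sqinter> (b \<sqinter> x) \<sqinter> (x \<sqinter> a)"
    by (rule meet_R_translate) (use S in \<open>simp_all add: meet_assoc\<close>)
  then have "(x \<sqinter> a \<sqinter> x) \<sqinter> (b \<sqinter> x) \<sqinter> (x \<sqinter> a) \<sqinter> (b \<sqinter> x) = (x \<sqinter> a) \<sqinter> (b \<sqinter> x) \<sqinter> (x \<sqinter> a) \<sqinter> (b \<sqinter> x)"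
    by simp
  then have QP: "?Q \<sqinter> ?P = ?P"
    using S meet_left_idem[of "x \<sqinter> a \<sqinter> b" x] by (simp add: meet_assoc)
  have "(x \<sqinter> b \<sqinter> x) \<sqinter> (x \<sqinter> a) \<sqinter> (b \<sqinter> x) = (x \<sqinter> b \<sqinter> x) \<sqinter> (x \<sqinter> a) \<sqinter> (x \<sqinter> b \<sqinter> x)"
    by (rule meet_L_translate) (use S in \<open>simp_all add: meet_assoc\<close>)
  then have "(x \<sqinter> a) \<sqinter> ((x \<sqinter> b \<sqinter> x) \<sqinter> (x \<sqinter> a) \<sqinter> (b \<sqinter> x))
      = (x \<sqinter> a) \<sqinter> ((x \<sqinter> b \<sqinter> x) \<sqinter> (x \<sqinter> a) \<sqinter> (x \<sqinter> b \<sqinter> x))"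
    by simp
  then have "?Q \<sqinter> ?P = ?Q \<sqinter> ?Q"
    using S by (simp add: meet_assoc del: meet_idem)
  then show ?thesis using QP S by simp
qed

lemmas join_regular = skew_lattice.meet_regular[OF order_dual]

section \<open>The lattice of \<open>\<D>\<close>-classes\<close>

lemma dominates_refl: "a \<in> S \<Longrightarrow> a \<succeq> a"
  by (simp add: natural_preorder_def)

lemma dominates_join_left: "\<lbrakk>a \<in> S; b \<in> S\<rbrakk> \<Longrightarrow> a \<squnion> b \<succeq> a"
  and dominates_join_right: "\<lbrakk>a \<in> S; b \<in> S\<rbrakk> \<Longrightarrow> a \<squnion> b \<succeq> b"
  by (simp_all add: natural_preorder_def join_assoc)

lemma meet_left_dominated: "\<lbrakk>a \<in> S; b \<in> S\<rbrakk> \<Longrightarrow> a \<succeq> a \<sqinter> b"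
  and meet_right_dominated: "\<lbrakk>a \<in> S; b \<in> S\<rbrakk> \<Longrightarrow> b \<succeq> a \<sqinter> b"
  by (simp_all add: dominates_meet_iff meet_assoc)

lemma dominates_trans:
  assumes S: "a \<in> S" "b \<in> S" "c \<in> S" and "a \<succeq> b" "b \<succeq> c"
  shows "a \<succeq> c"
proof -
  have bc: "b \<sqinter> a \<sqinter> b = b" "c \<sqinter> b \<sqinter> c = c"
    using assms by (simp_all add: dominates_meet_iff)
  have "(c \<sqinter> b) \<sqinter> a \<sqinter> (b \<sqinter> c) = c \<sqinter> (b \<sqinter> a \<sqinter> b) \<sqinter> c"
    using S by (simp add: meet_assoc)
  then show ?thesis
    using bc dominates_factor[of a "c \<sqinter> b" "b \<sqinter> c"] S by simp
qed

lemma dominates_joinI: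
  assumes S: "a \<in> S" "b \<in> S" "c \<in> S" and "a \<succeq> b" "a \<succeq> c"
  shows "a \<succeq> b \<squnion> c"
proof -
  have "a \<squnion> (b \<squnion> c) \<squnion> a = (a \<squnion> b \<squnion> a) \<squnion> c \<squnion> a"
    using join_regular[of a b c] S by (simp add: join_assoc)
  then show ?thesis using assms by (simp add: natural_preorder_def)
qed

lemma dominated_meetI:
  assumes "a \<in> S" "b \<in> S" "c \<in> S" "b \<succeq> a" "c \<succeq> a"
  shows "b \<sqinter> c \<succeq> a"
  using skew_lattice.dominates_joinI[OF order_dual, of a b c] assms
  by (simp add: dominates_order_dual)

abbreviation D_equiv :: "'a \<Rightarrow> 'a \<Rightarrow> bool"  (infix "\<approx>" 50) where
  "a \<approx> b \<equiv> a \<succeq> b \<and> b \<succeq> a"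

lemma D_class_rectangular:
  assumes S: "a \<in> S" "b \<in> S" and "a \<approx> b"
  shows "a \<sqinter> b = b \<squnion> a"
proof -
  have aba: "a \<squnion> b \<squnion> a = a" "a \<sqinter> b \<sqinter> a = a"
    using assms dominates_meet_iff[of b a] by (simp_all add: natural_preorder_def)
  have "a \<sqinter> b = (a \<sqinter> b) \<squnion> ((a \<sqinter> b) \<sqinter> a)"
    using S join_absorb_left[of "a \<sqinter> b" a] by simp
  also have "\<dots> = (a \<sqinter> b) \<squnion> (a \<squnion> b \<squnion> a)"
    using aba by simp
  also have "\<dots> = (((a \<sqinter> b) \<squnion> a) \<squnion> b) \<squnion> a"
    using S by (simp add: join_assoc)
  also have "(a \<sqinter> b) \<squnion> a = a \<sqinter> b"
    using S join_absorb_left[of "a \<sqinter> b" a] aba by simp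
  finally show ?thesis using S by (simp add: join_absorb_right)
qed

lemma meet_mono_D:
  assumes "a \<in> S" "a' \<in> S" "b \<in> S" "b' \<in> S" "a \<succeq> a'" "b \<succeq> b'"
  shows "a \<sqinter> b \<succeq> a' \<sqinter> b'"
  using assms meet_left_dominated[of a' b'] meet_right_dominated[of a' b']
    dominates_trans[of a a' "a' \<sqinter> b'"] dominates_trans[of b b' "a' \<sqinter> b'"]
  by (simp add: dominated_meetI)

lemma join_mono_D:
  assumes "a \<in> S" "a' \<in> S" "b \<in> S" "b' \<in> S" "a \<succeq> a'" "b \<succeq> b'"
  shows "a \<squnion> b \<succeq> a' \<squnion> b'"
  using assms dominates_join_left[of a b] dominates_join_right[of a b]
    dominates_trans[of "a \<squnion> b" a a'] dominates_trans[of "a \<squnion> b" b b']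
  by (simp add: dominates_joinI)


section \<open>Images below an element\<close>

definition under :: "'a \<Rightarrow> 'a \<Rightarrow> 'a" where
  "under x t = x \<sqinter> t \<sqinter> x"

lemma under_closed [simp, intro]: "\<lbrakk>x \<in> S; t \<in> S\<rbrakk> \<Longrightarrow> under x t \<in> S"
  by (simp add: under_def)

lemma under_dominated:
  assumes "x \<in> S" "t \<in> S"
  shows "x \<succeq> under x t" and "t \<succeq> under x t"
  using assms by (simp_all add: under_def dominates_meet_iff meet_assoc)

lemma dominated_underI:
  assumes "x \<in> S" "t \<in> S" "c \<in> S" "x \<succeq> c" "t \<succeq> c"
  shows "under x t \<succeq> c"
  unfolding under_def using assms by (intro dominated_meetI) auto

lemma under_D_equiv:
  assumes "x \<in> S" "t \<in> S"
  shows "under x t \<approx> x \<sqinter> t"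
  using assms dominated_underI[of x t "x \<sqinter> t"]
  by (simp add: under_def meet_left_dominated meet_right_dominated)

text \<open>This makes it possible to exchange \<open>t\<close> for \<open>under t x\<close>, an element that \<open>x\<close> dominates, without
  changing the image below \<open>x\<close>.\<close>

lemma under_under_swap:
  assumes "x \<in> S" "t \<in> S"
  shows "under x (under t x) = under x t"
  using assms by (simp add: under_def meet_assoc)

lemma under_meet:
  assumes "x \<in> S" "a \<in> S" "b \<in> S"
  shows "under x (a \<sqinter> b) = under x a \<sqinter> under x b"
  using meet_regular[of x a b] assms by (simp add: under_def meet_assoc)

lemma under_mono_D:
  assumes "x \<in> S" "a \<in> S" "b \<in> S" "a \<succeq> b"
  shows "under x a \<succeq> under x b"
  unfolding under_def using assms by (intro meet_mono_D) (auto intro: dominates_refl)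

text \<open>Inside a \<open>\<D>\<close>-class the join is the reversed meet, so this is \<open>under_meet\<close> in disguise.\<close>

lemma under_join_D_equiv:
  assumes "x \<in> S" "a \<in> S" "b \<in> S" "a \<approx> b"
  shows "under x (a \<squnion> b) = under x a \<squnion> under x b"
proof -
  have "under x (a \<squnion> b) = under x (b \<sqinter> a)"
    using assms D_class_rectangular[of b a] by simp
  also have "\<dots> = under x b \<sqinter> under x a"
    using assms by (simp add: under_meet)
  also have "\<dots> = under x a \<squnion> under x b"
    using assms by (intro D_class_rectangular conjI under_mono_D) auto
  finally show ?thesis .
qed

text \<open>Passing to a smaller element \<open>a\<close> in the natural partial order does not change the image below \<open>x\<close>
  as long as the images stay in one \<open>\<D>\<close>-class: \<open>under x\<close> preserves the partial order, and
  \<open>\<D>\<close>-related elements that are comparable in it are equal.\<close>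

lemma under_eq_if_below:
  assumes S: "x \<in> S" "a \<in> S" "b \<in> S"
    and below: "a \<squnion> b = b" "b \<squnion> a = b" and dom: "a \<succeq> under x b"
  shows "under x a = under x b"
proof -
  have "a \<sqinter> b = a" "b \<sqinter> a = a"
    using below S meet_absorb_left[of a b] meet_absorb_right[of a b] by simp_all
  then have "under x a \<sqinter> under x b = under x a" "under x b \<sqinter> under x a = under x a"
    using S by (simp_all add: under_meet[symmetric])
  moreover have "under x a \<succeq> under x b"
    using S dom by (intro dominated_underI under_dominated) auto
  then have "under x b \<sqinter> under x a \<sqinter> under x b = under x b"
    using S by (simp add: dominates_meet_iff)
  ultimately show ?thesis by simp
qed

section \<open>Preservation of joins\<close>

text \<open>The subalgebra generated by a chain is awkward to describe, but the union \<open>T\<close> of the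
  \<open>\<D>\<close>-classes of its elements is a totally preordered subalgebra: the meet and the join of two
  comparable elements are \<open>\<D>\<close>-related to one of them.\<close>

lemma linearly_distributive_on_chain:
  assumes ld: "linearly_distributive (\<sqinter>) (\<squnion>) S"
    and S: "x \<in> S" "y \<in> S" "z \<in> S" and chain: "x \<succeq> y" "y \<succeq> z"
  shows "under x (y \<squnion> z) = under x y \<squnion> under x z"
    and "under x (z \<squnion> y) = under x z \<squnion> under x y"
proof -
  define T where "T = {t \<in> S. t \<approx> x \<or> t \<approx> y \<or> t \<approx> z}"
  have xz: "x \<succeq> z" using dominates_trans S chain by blast
  have comparable: "s \<succeq> t \<or> t \<succeq> s" if "s \<in> T" "t \<in> T" for s t
    using that S chain xz dominates_trans unfolding T_def by (smt (verit) mem_Collect_eq)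
  have D_closed: "t \<in> T" if "s \<in> T" "t \<in> S" "s \<approx> t" for s t
    using that S dominates_trans unfolding T_def by (smt (verit) mem_Collect_eq)
  have T_S: "t \<in> S" if "t \<in> T" for t
    using that by (simp add: T_def)
  have "s \<sqinter> t \<in> T \<and> s \<squnion> t \<in> T \<and> t \<sqinter> s \<in> T \<and> t \<squnion> s \<in> T"
    if st: "s \<in> T" "t \<in> T" "s \<succeq> t" for s t
  proof -
    have "t \<approx> s \<sqinter> t" "t \<approx> t \<sqinter> s" "s \<approx> s \<squnion> t" "s \<approx> t \<squnion> s"
      using st T_S by (auto intro: dominated_meetI dominates_joinI dominates_refl
          meet_left_dominated meet_right_dominated dominates_join_left dominates_join_right)
    then show ?thesis using st T_S D_closed by blast
  qed
  then have "subalgebra (\<sqinter>) (\<squnion>) T S"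
    using comparable T_S unfolding subalgebra_def by blast
  then have "distributive (\<sqinter>) (\<squnion>) T"
    using ld comparable unfolding linearly_distributive_def by blast
  moreover have "x \<in> T" "y \<in> T" "z \<in> T"
    using S by (auto simp: T_def intro: dominates_refl)
  ultimately show "under x (y \<squnion> z) = under x y \<squnion> under x z"
    and "under x (z \<squnion> y) = under x z \<squnion> under x y"
    by (simp_all add: distributive_def meet_distributive_def under_def)
qed

text \<open>Here \<open>x\<close> and \<open>s\<close> may be unrelated. The element \<open>m = under s x\<close> lies between \<open>y\<close> and \<open>x\<close>, so linear
  distributivity applies to \<open>x\<close>, \<open>m\<close> and \<open>y\<close>. Moreover \<open>m\<close> is below \<open>s\<close> in the natural partial order, and
  regularity of the join carries this over to \<open>a = y \<squnion> m \<squnion> y\<close> and \<open>b = y \<squnion> s \<squnion> y\<close>, whose images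
  below \<open>x\<close> therefore agree.\<close>

lemma under_sandwich_join:
  assumes ld: "linearly_distributive (\<sqinter>) (\<squnion>) S"
    and S: "x \<in> S" "y \<in> S" "s \<in> S" and dom: "x \<succeq> y" "s \<succeq> y"
  shows "under x (y \<squnion> s \<squnion> y) = under x y \<squnion> under x s \<squnion> under x y"
proof -
  define m where "m = under s x"
  define a where "a = y \<squnion> m \<squnion> y"
  define b where "b = y \<squnion> s \<squnion> y"
  have mS: "m \<in> S" and aS: "a \<in> S" and bS: "b \<in> S" using S by (simp_all add: m_def a_def b_def)
  have m: "x \<succeq> m" "s \<succeq> m" "m \<succeq> y" "under x m = under x s"
    using S dom by (auto simp: m_def under_dominated dominated_underI under_under_swap)
  have "m \<sqinter> s = m" "s \<sqinter> m = m"
    using S by (simp_all add: m_def under_def meet_assoc)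
  then have ms: "m \<squnion> s = s" "s \<squnion> m = s"
    using S mS join_absorb_left[of s m] join_absorb_right[of s m] by simp_all
  have "a \<squnion> b = y \<squnion> (m \<squnion> s) \<squnion> y"
    using S mS join_regular[of y m s] by (simp add: a_def b_def join_assoc)
  moreover have "b \<squnion> a = y \<squnion> (s \<squnion> m) \<squnion> y"
    using S mS join_regular[of y s m] by (simp add: a_def b_def join_assoc)
  ultimately have ab: "a \<squnion> b = b" "b \<squnion> a = b"
    using ms by (simp_all add: b_def)
  have "s \<succeq> b"
    using S dom by (auto simp: b_def intro!: dominates_joinI dominates_refl)
  then have "under s x \<succeq> under x b"
    using S bS under_dominated[of x b] dominates_trans[of s b "under x b"]
    by (simp add: dominated_underI)
  moreover have "a \<succeq> m"
    using S mS dominates_join_right[of "y" m] dominates_join_left[of "y \<squnion> m" y]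
      dominates_trans[of a "y \<squnion> m" m] by (simp add: a_def)
  ultimately have "a \<succeq> under x b"
    using dominates_trans[of a m "under x b"] S aS bS mS by (simp add: m_def)
  then have "under x b = under x a"
    using under_eq_if_below[of x a b] S aS bS ab by simp
  also have "\<dots> = under x (y \<squnion> m) \<squnion> under x y"
    unfolding a_def using S dom mS m
    by (intro linearly_distributive_on_chain(1)[OF ld])
      (simp_all add: dominates_joinI dominates_join_left)
  also have "\<dots> = under x y \<squnion> under x m \<squnion> under x y"
    using linearly_distributive_on_chain(2)[OF ld, of x m y] S mS m by simp
  finally show ?thesis using m by (simp add: b_def)
qed

text \<open>As \<open>s \<squnion> y \<squnion> s = s\<close>, \<open>identity_star\<close> at \<open>x\<close>, \<open>y\<close>, \<open>s\<close> reads
  \<open>under x (y' \<squnion> s \<squnion> y') = under x (y \<squnion> s \<squnion> y)\<close> with \<open>y' = under y x\<close>, and \<open>y'\<close> is dominated by both \<open>x\<close> and \<open>s\<close>.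
  The one-sided joins follow, since \<open>y \<squnion> s\<close> and \<open>s \<squnion> y\<close> are joins of the \<open>\<D>\<close>-related
  elements \<open>y \<squnion> s \<squnion> y\<close> and \<open>s\<close>.\<close>

lemma under_join_comparable:
  assumes ld: "linearly_distributive (\<sqinter>) (\<squnion>) S" and star: "identity_star (\<sqinter>) (\<squnion>) S"
    and S: "x \<in> S" "y \<in> S" "s \<in> S" and dom: "s \<succeq> y"
  shows "under x (y \<squnion> s) = under x y \<squnion> under x s"
    and "under x (s \<squnion> y) = under x s \<squnion> under x y"
proof -
  define y' where "y' = under y x"
  define b where "b = y \<squnion> s \<squnion> y"
  have y'S: "y' \<in> S" and bS: "b \<in> S" using S by (simp_all add: y'_def b_def)
  have y': "x \<succeq> y'" "s \<succeq> y'" "under x y' = under x y"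
    using S dom dominates_trans[of s y y']
    by (auto simp: y'_def under_dominated under_under_swap)
  have sys: "s \<squnion> y \<squnion> s = s" using dom by (simp add: natural_preorder_def)
  have "under x b = under x (y' \<squnion> (s \<squnion> y \<squnion> s) \<squnion> y')"
    using star S y'S
    by (simp add: identity_star_def under_def y'_def b_def join_assoc)
  also have "\<dots> = under x y \<squnion> under x s \<squnion> under x y"
    using under_sandwich_join[OF ld, of x y' s] sys S y'S y' by simp
  finally have b: "under x b = under x y \<squnion> under x s \<squnion> under x y" .
  have bs: "b \<approx> s"
    using S dom dominates_join_right[of "y" s] dominates_join_left[of "y \<squnion> s" y]
      dominates_trans[of b "y \<squnion> s" s] by (simp add: b_def dominates_joinI dominates_refl)
  have us: "under x s \<squnion> under x y \<squnion> under x s = under x s"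
    using under_mono_D[of x s y] S dom by (simp add: natural_preorder_def)
  have "b \<squnion> s = y \<squnion> (s \<squnion> y \<squnion> s)" "s \<squnion> b = (s \<squnion> y \<squnion> s) \<squnion> y"
    using S by (simp_all add: b_def join_assoc)
  then have "under x (y \<squnion> s) = under x b \<squnion> under x s" "under x (s \<squnion> y) = under x s \<squnion> under x b"
    using under_join_D_equiv[of x b s] under_join_D_equiv[of x s b] S bS bs sys by simp_all
  moreover have "under x b \<squnion> under x s = under x y \<squnion> (under x s \<squnion> under x y \<squnion> under x s)"
    "under x s \<squnion> under x b = (under x s \<squnion> under x y \<squnion> under x s) \<squnion> under x y"
    using S b by (simp_all add: join_assoc)
  ultimately show "under x (y \<squnion> s) = under x y \<squnion> under x s"
    and "under x (s \<squnion> y) = under x s \<squnion> under x y"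
    using us by simp_all
qed

text \<open>The first assumption is the nontrivial half of the distributive law in the lattice of
  \<open>\<D>\<close>-classes. It puts the two sides of the identity in one \<open>\<D>\<close>-class, where elements comparable in
  the natural partial order are equal.\<close>

lemma meet_distributive_if_star:
  assumes qd: "\<And>x y z. \<lbrakk>x \<in> S; y \<in> S; z \<in> S\<rbrakk> \<Longrightarrow> (x \<sqinter> y) \<squnion> (x \<sqinter> z) \<succeq> x \<sqinter> (y \<squnion> z)"
    and ld: "linearly_distributive (\<sqinter>) (\<squnion>) S" and star: "identity_star (\<sqinter>) (\<squnion>) S"
  shows "meet_distributive (\<sqinter>) (\<squnion>) S"
proof -
  have "under x (y \<squnion> z) = under x y \<squnion> under x z" if S: "x \<in> S" "y \<in> S" "z \<in> S" for x y z
  proof -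
    define p where "p = y \<squnion> z"
    define q where "q = under x y \<squnion> under x z"
    have pS: "p \<in> S" and qS: "q \<in> S" using S by (simp_all add: p_def q_def)
    note comparable = under_join_comparable[OF ld star]
    have p: "p \<succeq> y" "p \<succeq> z"
      using S by (auto simp: p_def intro: dominates_join_left dominates_join_right)
    have py: "p \<squnion> y \<succeq> z" "z \<squnion> p \<succeq> y"
      using S pS p dominates_trans[of "p \<squnion> y" p z] dominates_trans[of "z \<squnion> p" p y]
      by (simp_all add: dominates_join_left dominates_join_right)
    have "under x p = under x ((p \<squnion> y) \<squnion> z)"
      using S by (simp add: p_def join_assoc)
    also have "\<dots> = under x p \<squnion> q"
      using comparable(2)[of x z "p \<squnion> y"] comparable(2)[of x y p] S pS p py
      by (simp add: q_def join_assoc)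
    finally have pq: "under x p = under x p \<squnion> q" .
    have "under x p = under x (y \<squnion> (z \<squnion> p))"
      using S by (simp add: p_def join_assoc)
    also have "\<dots> = q \<squnion> under x p"
      using comparable(1)[of x y "z \<squnion> p"] comparable(1)[of x z p] S pS p py
      by (simp add: q_def join_assoc)
    finally have qp: "under x p = q \<squnion> under x p" .
    \<comment> \<open>So \<open>under x p\<close> is above \<open>q\<close> in the natural partial order, and it remains to see that \<open>q\<close> dominates it.\<close>
    have "q \<succeq> (x \<sqinter> y) \<squnion> (x \<sqinter> z)"
      unfolding q_def using S under_D_equiv[of x y] under_D_equiv[of x z]
      by (intro join_mono_D) simp_all
    moreover have "(x \<sqinter> y) \<squnion> (x \<sqinter> z) \<succeq> x \<sqinter> p"
      unfolding p_def by (rule qd) fact+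
    moreover have "x \<sqinter> p \<succeq> under x p"
      using under_D_equiv S pS by blast
    ultimately have "q \<succeq> under x p"
      using dominates_trans[of q "(x \<sqinter> y) \<squnion> (x \<sqinter> z)" "x \<sqinter> p"]
        dominates_trans[of q "x \<sqinter> p" "under x p"] S pS qS by blast
    then have "q \<squnion> under x p \<squnion> q = q" by (simp add: natural_preorder_def)
    then have "under x p = q" using pq qp by metis
    then show ?thesis by (simp add: p_def q_def)
  qed
  then show ?thesis by (simp add: meet_distributive_def under_def)
qed

text \<open>The map \<open>under x\<close> identifies \<open>under y x\<close> with \<open>y\<close>, so when it preserves joins, the two sides of
  \<open>identity_star\<close> differ only by a repetition in a join.\<close>

lemma star_if_meet_distributive:
  assumes "meet_distributive (\<sqinter>) (\<squnion>) S"
  shows "identity_star (\<sqinter>) (\<squnion>) S"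
  unfolding identity_star_def
proof (intro ballI)
  fix x y z assume S: "x \<in> S" "y \<in> S" "z \<in> S"
  have hom: "under x (a \<squnion> b) = under x a \<squnion> under x b" if "a \<in> S" "b \<in> S" for a b
    using assms that S by (simp add: meet_distributive_def under_def)
  have "under x (under y x \<squnion> z \<squnion> y \<squnion> z \<squnion> under y x) = under x (y \<squnion> z \<squnion> y)"
    using S by (simp add: hom under_under_swap join_assoc)
  then show "x \<sqinter> ((y \<sqinter> x \<sqinter> y) \<squnion> z \<squnion> y \<squnion> z \<squnion> (y \<sqinter> x \<sqinter> y)) \<sqinter> x = x \<sqinter> (y \<squnion> z \<squnion> y) \<sqinter> x"
    by (simp add: under_def)
qed

section \<open>Quasi-distributivity in terms of elements\<close>

lemma D_rel_iff: "(a, b) \<in> D_rel (\<squnion>) S \<longleftrightarrow> a \<in> S \<and> b \<in> S \<and> a \<approx> b"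
  by (simp add: D_rel_def)

lemma equiv_D: "equiv S (D_rel (\<squnion>) S)"
  by (intro equivI refl_onI symI transI)
    (auto simp: D_rel_iff intro: dominates_refl dominates_trans)

abbreviation D_class :: "'a \<Rightarrow> 'a set" where
  "D_class a \<equiv> D_rel (\<squnion>) S `` {a}"

lemma D_class_eq_iff: "\<lbrakk>a \<in> S; b \<in> S\<rbrakk> \<Longrightarrow> D_class a = D_class b \<longleftrightarrow> a \<approx> b"
  using eq_equiv_class_iff[OF equiv_D] by (simp add: D_rel_iff)

lemma quotient_meet:
  assumes S: "a \<in> S" "b \<in> S"
  shows "quotient_op (\<squnion>) S (\<sqinter>) (D_class a) (D_class b) = D_class (a \<sqinter> b)"
proof -
  have "quotient_op (\<squnion>) S (\<sqinter>) (D_class a) (D_class b)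
      = (\<Union>a'\<in>D_class a. \<Union>b'\<in>D_class b. D_class (a \<sqinter> b))"
    unfolding quotient_op_def
  proof (intro SUP_cong refl)
    fix a' b' assume "a' \<in> D_class a" "b' \<in> D_class b"
    then show "D_class (a' \<sqinter> b') = D_class (a \<sqinter> b)"
      using S by (simp add: D_class_eq_iff D_rel_iff meet_mono_D)
  qed
  moreover have "D_class a \<noteq> {}" "D_class b \<noteq> {}"
    using S equiv_class_self[OF equiv_D] by blast+
  ultimately show ?thesis by simp
qed

lemma quotient_join:
  assumes S: "a \<in> S" "b \<in> S"
  shows "quotient_op (\<squnion>) S (\<squnion>) (D_class a) (D_class b) = D_class (a \<squnion> b)"
proof -
  have "quotient_op (\<squnion>) S (\<squnion>) (D_class a) (D_class b)
      = (\<Union>a'\<in>D_class a. \<Union>b'\<in>D_class b. D_class (a \<squnion> b))"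
    unfolding quotient_op_def
  proof (intro SUP_cong refl)
    fix a' b' assume "a' \<in> D_class a" "b' \<in> D_class b"
    then show "D_class (a' \<squnion> b') = D_class (a \<squnion> b)"
      using S by (simp add: D_class_eq_iff D_rel_iff join_mono_D)
  qed
  moreover have "D_class a \<noteq> {}" "D_class b \<noteq> {}"
    using S equiv_class_self[OF equiv_D] by blast+
  ultimately show ?thesis by simp
qed

lemma meet_commute_D: "\<lbrakk>a \<in> S; b \<in> S\<rbrakk> \<Longrightarrow> a \<sqinter> b \<approx> b \<sqinter> a"
  by (intro conjI dominated_meetI) (auto intro: meet_left_dominated meet_right_dominated)

lemma join_commute_D: "\<lbrakk>a \<in> S; b \<in> S\<rbrakk> \<Longrightarrow> a \<squnion> b \<approx> b \<squnion> a"
  by (intro conjI dominates_joinI) (auto intro: dominates_join_left dominates_join_right)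

lemma quasi_distributive_iff:
  "quasi_distributive (\<sqinter>) (\<squnion>) S \<longleftrightarrow>
    (\<forall>x\<in>S. \<forall>y\<in>S. \<forall>z\<in>S. x \<sqinter> (y \<squnion> z) \<approx> (x \<sqinter> y) \<squnion> (x \<sqinter> z))"
proof
  assume "quasi_distributive (\<sqinter>) (\<squnion>) S"
  then interpret quotient: distributive_lattice_on
    "quotient_op (\<squnion>) S (\<sqinter>)" "quotient_op (\<squnion>) S (\<squnion>)" "S // D_rel (\<squnion>) S"
    by (simp add: quasi_distributive_def)
  show "\<forall>x\<in>S. \<forall>y\<in>S. \<forall>z\<in>S. x \<sqinter> (y \<squnion> z) \<approx> (x \<sqinter> y) \<squnion> (x \<sqinter> z)"
  proof (intro ballI)
    fix x y z assume S: "x \<in> S" "y \<in> S" "z \<in> S"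
    then show "x \<sqinter> (y \<squnion> z) \<approx> (x \<sqinter> y) \<squnion> (x \<sqinter> z)"
      using quotient.distrib[of "D_class x" "D_class y" "D_class z"]
      by (simp add: quotientI quotient_meet quotient_join D_class_eq_iff)
  qed
next
  assume distrib: "\<forall>x\<in>S. \<forall>y\<in>S. \<forall>z\<in>S. x \<sqinter> (y \<squnion> z) \<approx> (x \<sqinter> y) \<squnion> (x \<sqinter> z)"
  then have distrib_D: "D_class (x \<sqinter> (y \<squnion> z)) = D_class ((x \<sqinter> y) \<squnion> (x \<sqinter> z))"
    if "x \<in> S" "y \<in> S" "z \<in> S" for x y z
    using that by (simp add: D_class_eq_iff)
  have commute_D: "D_class (x \<sqinter> y) = D_class (y \<sqinter> x)" "D_class (x \<squnion> y) = D_class (y \<squnion> x)"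
    if "x \<in> S" "y \<in> S" for x y
    using that by (simp_all add: D_class_eq_iff meet_commute_D join_commute_D)
  note ops = quotient_meet quotient_join
  show "quasi_distributive (\<sqinter>) (\<squnion>) S"
    unfolding quasi_distributive_def
    by unfold_locales
      (elim quotientE; simp add: ops quotientI meet_assoc join_assoc meet_absorb_left
        join_absorb_left distrib_D; fail | elim quotientE; simp add: ops; rule commute_D; assumption)+
qed

section \<open>Duality and the equivalences\<close>

lemma D_rel_order_dual: "D_rel (\<sqinter>) S = D_rel (\<squnion>) S"
  by (auto simp: D_rel_def dominates_order_dual)

lemma quasi_distributive_order_dual:
  assumes "quasi_distributive (\<sqinter>) (\<squnion>) S"
  shows "quasi_distributive (\<squnion>) (\<sqinter>) S"
proof -
  have "quotient_op (\<sqinter>) S = quotient_op (\<squnion>) S"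
    by (intro ext) (simp add: quotient_op_def D_rel_order_dual)
  then show ?thesis
    using assms distributive_lattice_on.distributive_lattice_on_order_dual
    by (simp add: quasi_distributive_def D_rel_order_dual)
qed

lemma linearly_distributive_order_dual:
  assumes "linearly_distributive (\<sqinter>) (\<squnion>) S"
  shows "linearly_distributive (\<squnion>) (\<sqinter>) S"
  unfolding linearly_distributive_def
proof (intro allI impI)
  fix T
  assume T: "subalgebra (\<squnion>) (\<sqinter>) T S \<and>
    (\<forall>a\<in>T. \<forall>b\<in>T. natural_preorder (\<sqinter>) a b \<or> natural_preorder (\<sqinter>) b a)"
  then have sub: "subalgebra (\<sqinter>) (\<squnion>) T S"
    by (auto simp: subalgebra_def)
  moreover have "a \<succeq> b \<or> b \<succeq> a" if "a \<in> T" "b \<in> T" for a b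
  proof -
    have "a \<in> S" "b \<in> S"
      using T that by (auto simp: subalgebra_def)
    then show ?thesis
      using T that dominates_order_dual by blast
  qed
  ultimately have "distributive (\<sqinter>) (\<squnion>) T"
    using assms by (simp add: linearly_distributive_def)
  then show "distributive (\<squnion>) (\<sqinter>) T"
    by (simp add: distributive_def meet_distributive_def join_distributive_def)
qed

lemma meet_distributive_iff_star:
  assumes qd: "quasi_distributive (\<sqinter>) (\<squnion>) S" and ld: "linearly_distributive (\<sqinter>) (\<squnion>) S"
  shows "meet_distributive (\<sqinter>) (\<squnion>) S \<longleftrightarrow> identity_star (\<sqinter>) (\<squnion>) S"
  using meet_distributive_if_star[OF _ ld] star_if_meet_distributive qd
  by (auto simp: quasi_distributive_iff)

lemma join_distributive_eq: "join_distributive (\<sqinter>) (\<squnion>) S = meet_distributive (\<squnion>) (\<sqinter>) S"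
  by (simp add: join_distributive_def meet_distributive_def)

lemma identity_star_dual_eq: "identity_star_dual (\<sqinter>) (\<squnion>) S = identity_star (\<squnion>) (\<sqinter>) S"
  by (simp add: identity_star_dual_def identity_star_def)

lemma join_distributive_iff_star_dual:
  assumes "quasi_distributive (\<sqinter>) (\<squnion>) S" "linearly_distributive (\<sqinter>) (\<squnion>) S"
  shows "join_distributive (\<sqinter>) (\<squnion>) S \<longleftrightarrow> identity_star_dual (\<sqinter>) (\<squnion>) S"
  unfolding join_distributive_eq identity_star_dual_eq
  using assms
  by (intro skew_lattice.meet_distributive_iff_star[OF order_dual]
      quasi_distributive_order_dual linearly_distributive_order_dual)

lemma quasi_distributive_if_meet_distributive:
  assumes "meet_distributive (\<sqinter>) (\<squnion>) S"
  shows "quasi_distributive (\<sqinter>) (\<squnion>) S"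
  unfolding quasi_distributive_iff
proof (intro ballI)
  fix x y z assume S: "x \<in> S" "y \<in> S" "z \<in> S"
  have "x \<sqinter> (y \<squnion> z) \<approx> under x (y \<squnion> z)"
    using S under_D_equiv[of x "y \<squnion> z"] by simp
  moreover have "under x (y \<squnion> z) = under x y \<squnion> under x z"
    using assms S by (simp add: meet_distributive_def under_def)
  moreover have "under x y \<squnion> under x z \<approx> (x \<sqinter> y) \<squnion> (x \<sqinter> z)"
    using S by (simp add: join_mono_D under_D_equiv)
  ultimately show "x \<sqinter> (y \<squnion> z) \<approx> (x \<sqinter> y) \<squnion> (x \<sqinter> z)"
    using S dominates_trans[of "x \<sqinter> (y \<squnion> z)" "under x (y \<squnion> z)" "(x \<sqinter> y) \<squnion> (x \<sqinter> z)"]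
      dominates_trans[of "(x \<sqinter> y) \<squnion> (x \<sqinter> z)" "under x (y \<squnion> z)" "x \<sqinter> (y \<squnion> z)"]
    by simp
qed

lemma distributive_iff:
  "distributive (\<sqinter>) (\<squnion>) S \<longleftrightarrow>
    quasi_distributive (\<sqinter>) (\<squnion>) S \<and> linearly_distributive (\<sqinter>) (\<squnion>) S
    \<and> identity_star (\<sqinter>) (\<squnion>) S \<and> identity_star_dual (\<sqinter>) (\<squnion>) S"
proof
  assume dist: "distributive (\<sqinter>) (\<squnion>) S"
  then have qd: "quasi_distributive (\<sqinter>) (\<squnion>) S"
    by (simp add: distributive_def quasi_distributive_if_meet_distributive)
  moreover have ld: "linearly_distributive (\<sqinter>) (\<squnion>) S"
    using dist unfolding linearly_distributive_def distributive_def subalgebra_def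
      meet_distributive_def join_distributive_def by blast
  ultimately show "quasi_distributive (\<sqinter>) (\<squnion>) S \<and> linearly_distributive (\<sqinter>) (\<squnion>) S
    \<and> identity_star (\<sqinter>) (\<squnion>) S \<and> identity_star_dual (\<sqinter>) (\<squnion>) S"
    using dist meet_distributive_iff_star join_distributive_iff_star_dual
    by (simp add: distributive_def)
qed (simp add: distributive_def meet_distributive_iff_star join_distributive_iff_star_dual)

end

theorem theorem5p6:
  fixes meet join :: "'a \<Rightarrow> 'a \<Rightarrow> 'a" and S :: "'a set"
  assumes "skew_lattice meet join S"
  shows "(quasi_distributive meet join S \<and> linearly_distributive meet join S \<longrightarrow>
            (meet_distributive meet join S \<longleftrightarrow> identity_star meet join S))
       \<and> (quasi_distributive meet join S \<and> linearly_distributive meet join S \<longrightarrow>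
            (join_distributive meet join S \<longleftrightarrow> identity_star_dual meet join S))
       \<and> (distributive meet join S \<longleftrightarrow>
            quasi_distributive meet join S \<and> linearly_distributive meet join S
            \<and> identity_star meet join S \<and> identity_star_dual meet join S)"
proof -
  interpret skew_lattice meet join S by (fact assms)
  show ?thesis
    using meet_distributive_iff_star join_distributive_iff_star_dual distributive_iff by blast
qed

end
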